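(* Let $K$ be a finite abstract simplicial complex with a linearly ordered vertex set $(V,\preceq)$, and let $W$ be the partial matching on the face poset of $K$ produced by the algorithm $\mathcal A$. Then $W$ is a gradient field on $K$.
   Context: $K$ has dimension $d$; faces are nonempty and $\mathcal F^i$ is the set of $i$-dimensional faces. (In general the vertex set may only carry a partial order that is linear on each face; it is then first extended to a linear order.) A face $\alpha\in\mathcal F^i$ is written $[\alpha_0,\ldots,\alpha_i]$ with $\alpha_0\prec\cdots\prec\alpha_i$, and $\alpha_r$ is said to appear in position $r$ of $\alpha$. Faces are ordered lexicographically. Algorithm $\mathcal A$: start with $W:=\varnothing$ and $F^i:=\mathcal F^i$ for $0\le i\le d$. For $i=d-1,d-2,\ldots,0$ in this order, run process $\mathcal P^i$ provided $F^i$ and $F^{i+1}$ are both nonempty at that moment. Process $\mathcal P^i$ runs $r=i+1,i,\ldots,0$ in descending order; for each $r$ it runs over all $v\in V$ from the $\preceq$-largest to the smallest; for each $(r,v)$ it runs over all $\alpha\in\mathcal F^i$ in increasing lexicographic order. For each $(i,r,v,\alpha)$: if $v\notin\alpha$, $\alpha\cup\{v\}\in\mathcal F^{i+1}$ with $v$ appearing in position $r$ of $\alpha\cup\{v\}$, and at that moment $\alpha\in F^i$ and $\alpha\cup\{v\}\in F^{i+1}$, then add the pair $(\alpha,\alpha\cup\{v\})$ to $W$ (written $\alpha\nearrow\alpha\cup\{v\}$), and remove $\alpha$ from $F^i$ and $\alpha\cup\{v\}$ from $F^{i+1}$. Gradient field: a partial matching $W$ (a set of pairs $\alpha\nearrow\beta$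 with $\alpha\subset\beta$, $\dim\beta=\dim\alpha+1$, each face in at most one pair) is a gradient field if the modified Hasse diagram, i.e. the directed graph on faces with edges $\beta\searrow\alpha$ for each codimension-one inclusion $\alpha\subset\beta$ not in $W$ and edges $\alpha\nearrow\beta$ for pairs in $W$, has no cycles $\alpha_0\nearrow\beta_1\searrow\alpha_1\nearrow\cdots\nearrow\beta_k\searrow\alpha_k=\alpha_0$ or $\gamma_0\searrow\delta_1\nearrow\gamma_1\searrow\cdots\searrow\delta_k\nearrow\gamma_k=\gamma_0$ with $k\ge1$. *)

theory Defs
  imports Main "HOL-Library.List_Lexorder"
begin

definition finite_simplicial_complex :: "'a set set \<Rightarrow> bool" where
  "finite_simplicial_complex K \<longleftrightarrow>
     finite K \<and> (\<forall>\<alpha>\<in>K. finite \<alpha> \<and> \<alpha> \<noteq> {}) \<and>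
     (\<forall>\<beta>\<in>K. \<forall>\<alpha>. \<alpha> \<noteq> {} \<and> \<alpha> \<subseteq> \<beta> \<longrightarrow> \<alpha> \<in> K)"

definition vertices :: "'a set set \<Rightarrow> 'a set" where
  "vertices K = \<Union>K"

text \<open>Natural subtraction is harmless here, since faces are finite and nonempty.\<close>

definition face_dim :: "'a set \<Rightarrow> nat" where
  "face_dim \<alpha> = card \<alpha> - 1"

definition faces :: "'a set set \<Rightarrow> nat \<Rightarrow> 'a set set" where
  "faces K i = {\<alpha> \<in> K. face_dim \<alpha> = i}"

text \<open>The empty complex, of dimension \<open>-1\<close>, is given the value \<open>0\<close>; in either
  case the algorithm below has no process to run on it.\<close>

definition complex_dim :: "'a set set \<Rightarrow> nat" where
  "complex_dim K = (if K = {} then 0 else Max (face_dim ` K))"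

text \<open>The linear order on the vertices is that of the type, so
  \<^term>\<open>sorted_list_of_set \<alpha>\<close> is the notation \<open>[\<alpha>\<^sub>0, \<dots>, \<alpha>\<^sub>i]\<close>. Positions start at \<open>0\<close>.\<close>

definition appears_in_position :: "'a::linorder \<Rightarrow> nat \<Rightarrow> 'a set \<Rightarrow> bool" where
  "appears_in_position v r \<alpha> \<longleftrightarrow> r < card \<alpha> \<and> sorted_list_of_set \<alpha> ! r = v"

text \<open>The \<open>i\<close>-faces in increasing lexicographic order: the inner
  \<^term>\<open>sorted_list_of_set\<close> turns each face into its increasing list of vertices,
  the outer one sorts these lists by the lexicographic order on lists.\<close>

definition lex_faces :: "'a::linorder set set \<Rightarrow> nat \<Rightarrow> 'a set list" where
  "lex_faces K i = map set (sorted_list_of_set (sorted_list_of_set ` faces K i))"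

text \<open>A state consists of the current \<open>W\<close> and the current family \<open>i \<mapsto> F\<^sup>i\<close>.\<close>

type_synonym 'a state = "('a set \<times> 'a set) set \<times> (nat \<Rightarrow> 'a set set)"

definition match_step ::
  "'a::linorder set set \<Rightarrow> nat \<Rightarrow> nat \<times> 'a \<times> 'a set \<Rightarrow> 'a state \<Rightarrow> 'a state" where
  "match_step K i = (\<lambda>(r, v, \<alpha>) (W, F).
     if v \<notin> \<alpha> \<and> \<alpha> \<union> {v} \<in> faces K (i + 1) \<and> appears_in_position v r (\<alpha> \<union> {v}) \<and>
        \<alpha> \<in> F i \<and> \<alpha> \<union> {v} \<in> F (i + 1)
     then (W \<union> {(\<alpha>, \<alpha> \<union> {v})},
           F(i := F i - {\<alpha>}, i + 1 := F (i + 1) - {\<alpha> \<union> {v}}))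
     else (W, F))"

definition process :: "'a::linorder set set \<Rightarrow> nat \<Rightarrow> 'a state \<Rightarrow> 'a state" where
  "process K i = fold (match_step K i)
     [(r, v, \<alpha>). r \<leftarrow> rev [0..<i + 2],
                  v \<leftarrow> rev (sorted_list_of_set (vertices K)),
                  \<alpha> \<leftarrow> lex_faces K i]"

definition run_process :: "'a::linorder set set \<Rightarrow> nat \<Rightarrow> 'a state \<Rightarrow> 'a state" where
  "run_process K i s = (if snd s i \<noteq> {} \<and> snd s (i + 1) \<noteq> {} then process K i s else s)"

definition algorithm_matching :: "'a::linorder set set \<Rightarrow> ('a set \<times> 'a set) set" where
  "algorithm_matching K =
     fst (fold (run_process K) (rev [0..<complex_dim K]) ({}, faces K))"

definition codim_one :: "'a set set \<Rightarrow> 'a set \<Rightarrow> 'a set \<Rightarrow> bool" where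
  "codim_one K \<alpha> \<beta> \<longleftrightarrow>
     \<alpha> \<in> K \<and> \<beta> \<in> K \<and> \<alpha> \<subset> \<beta> \<and> face_dim \<beta> = face_dim \<alpha> + 1"

definition partial_matching :: "'a set set \<Rightarrow> ('a set \<times> 'a set) set \<Rightarrow> bool" where
  "partial_matching K W \<longleftrightarrow>
     (\<forall>(\<alpha>, \<beta>) \<in> W. codim_one K \<alpha> \<beta>) \<and>
     (\<forall>p\<in>W. \<forall>q\<in>W. {fst p, snd p} \<inter> {fst q, snd q} \<noteq> {} \<longrightarrow> p = q)"

text \<open>The two kinds of edges of the modified Hasse diagram.\<close>

definition up_edge :: "('a set \<times> 'a set) set \<Rightarrow> 'a set \<Rightarrow> 'a set \<Rightarrow> bool" where
  "up_edge W \<alpha> \<beta> \<longleftrightarrow> (\<alpha>, \<beta>) \<in> W"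

definition down_edge :: "'a set set \<Rightarrow> ('a set \<times> 'a set) set \<Rightarrow> 'a set \<Rightarrow> 'a set \<Rightarrow> bool" where
  "down_edge K W \<beta> \<alpha> \<longleftrightarrow> codim_one K \<alpha> \<beta> \<and> (\<alpha>, \<beta>) \<notin> W"

definition up_down_cycle ::
  "'a set set \<Rightarrow> ('a set \<times> 'a set) set \<Rightarrow> nat \<Rightarrow> (nat \<Rightarrow> 'a set) \<Rightarrow> (nat \<Rightarrow> 'a set) \<Rightarrow> bool" where
  "up_down_cycle K W k \<alpha> \<beta> \<longleftrightarrow> k \<ge> 1 \<and>
     (\<forall>j<k. up_edge W (\<alpha> j) (\<beta> (j + 1)) \<and> down_edge K W (\<beta> (j + 1)) (\<alpha> (j + 1))) \<and>
     \<alpha> k = \<alpha> 0"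

definition down_up_cycle ::
  "'a set set \<Rightarrow> ('a set \<times> 'a set) set \<Rightarrow> nat \<Rightarrow> (nat \<Rightarrow> 'a set) \<Rightarrow> (nat \<Rightarrow> 'a set) \<Rightarrow> bool" where
  "down_up_cycle K W k \<gamma> \<delta> \<longleftrightarrow> k \<ge> 1 \<and>
     (\<forall>j<k. down_edge K W (\<gamma> j) (\<delta> (j + 1)) \<and> up_edge W (\<delta> (j + 1)) (\<gamma> (j + 1))) \<and>
     \<gamma> k = \<gamma> 0"

definition gradient_field :: "'a set set \<Rightarrow> ('a set \<times> 'a set) set \<Rightarrow> bool" where
  "gradient_field K W \<longleftrightarrow> partial_matching K W \<and>
     (\<nexists>k \<alpha> \<beta>. up_down_cycle K W k \<alpha> \<beta>) \<and>
     (\<nexists>k \<gamma> \<delta>. down_up_cycle K W k \<gamma> \<delta>)"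

end

theory Submission
  imports Defs "HOL-Library.Product_Lexorder"
begin

text \<open>The algorithm is a greedy matching. Give a pair \<open>\<alpha> \<nearrow> \<alpha> \<union> {v}\<close> the key consisting of the dimension
  of \<open>\<alpha>\<close>, the position \<open>r\<close> of \<open>v\<close> in \<open>\<alpha> \<union> {v}\<close>, and \<open>v\<close>. Then the loops visit all codimension-one
  pairs in order of decreasing key, lexicographically, and accept a pair exactly when both of its
  faces are still free (\<open>algorithm_matching_greedy\<close>, \<open>sorted_all_pairs\<close>). Hence the result is a
  matching, and each rejected pair meets an accepted pair whose key is at least as large
  (\<open>algorithm_blocked\<close>).

  Now follow a closed path \<open>\<alpha>\<^sub>0 \<nearrow> \<beta>\<^sub>0 \<searrow> \<alpha>\<^sub>1 \<nearrow> \<beta>\<^sub>1 \<searrow> \<dots>\<close>, where step \<open>j\<close> first adds a vertex \<open>v\<^sub>j\<close> and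
  then removes a vertex \<open>w\<^sub>j \<noteq> v\<^sub>j\<close>. If \<open>w\<^sub>j > v\<^sub>j\<close>, then \<open>\<alpha>\<^sub>j\<^sub>+\<^sub>1 \<nearrow> \<beta>\<^sub>j\<close> was tried and rejected before
  \<open>\<alpha>\<^sub>j \<nearrow> \<beta>\<^sub>j\<close> was accepted; it was \<open>\<alpha>\<^sub>j\<^sub>+\<^sub>1\<close> that was no longer free, so the pair
  \<open>\<alpha>\<^sub>j\<^sub>+\<^sub>1 \<nearrow> \<beta>\<^sub>j\<^sub>+\<^sub>1\<close> has a larger key than \<open>\<alpha>\<^sub>j\<^sub>+\<^sub>1 \<nearrow> \<beta>\<^sub>j\<close> (\<open>algorithm_key_increases\<close>).

  Let \<open>c\<close> be the largest position at which a vertex is added along the path, and let \<open>m\<^sub>j\<close> be the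
  vertex in position \<open>c\<close> of \<open>\<beta>\<^sub>j\<close>. Then \<open>m\<^sub>j\<close> never decreases, and it increases strictly whenever a
  vertex is added in position \<open>c\<close> (\<open>rank_climbs\<close>). This happens at least once in every period, so
  the path cannot close up.\<close>

section \<open>Greedy matchings\<close>

definition covered :: "('b \<times> 'b) set \<Rightarrow> 'b set" where
  "covered W = (\<Union>p\<in>W. {fst p, snd p})"

definition meets :: "'b \<times> 'b \<Rightarrow> 'b \<times> 'b \<Rightarrow> bool" where
  "meets p q \<longleftrightarrow> {fst p, snd p} \<inter> {fst q, snd q} \<noteq> {}"

definition greedy_step :: "'b \<times> 'b \<Rightarrow> ('b \<times> 'b) set \<Rightarrow> ('b \<times> 'b) set" where
  "greedy_step p W = (if {fst p, snd p} \<inter> covered W = {} then insert p W else W)"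

lemma covered_insert [simp]: "covered (insert p W) = {fst p, snd p} \<union> covered W"
  by (auto simp: covered_def)

lemma meets_covered: "{fst p, snd p} \<inter> covered W \<noteq> {} \<longleftrightarrow> (\<exists>q\<in>W. meets q p)"
  unfolding covered_def meets_def by blast

lemma greedy_disjoint:
  assumes "p \<in> fold greedy_step ps {}" "q \<in> fold greedy_step ps {}" "meets p q"
  shows "p = q"
  using assms
proof (induction ps arbitrary: p q rule: rev_induct)
  case (snoc x ps)
  let ?W = "fold greedy_step ps {}"
  show ?case
  proof (cases "{fst x, snd x} \<inter> covered ?W = {}")
    case True
    then have "\<not> meets y x" "\<not> meets x y" if "y \<in> ?W" for y
      using that meets_covered[of x ?W] by (auto simp: meets_def)
    moreover have "fold greedy_step (ps @ [x]) {} = insert x ?W"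
      using True by (simp add: greedy_step_def)
    moreover have "meets q p" using snoc.prems(3) by (auto simp: meets_def)
    ultimately show ?thesis using snoc by (metis insert_iff)
  next
    case False
    then have "fold greedy_step (ps @ [x]) {} = ?W" by (auto simp: greedy_step_def)
    with snoc show ?thesis by metis
  qed
qed simp

lemma greedy_subset: "fold greedy_step ps {} \<subseteq> set ps"
  by (induction ps rule: rev_induct) (auto simp: greedy_step_def split: if_splits)

text \<open>A pair is skipped only because one of its faces is covered at that moment, necessarily by a pair
  that comes earlier in the list.\<close>

lemma greedy_blocked:
  assumes "sorted_wrt P ps" "p \<in> set ps" "p \<notin> fold greedy_step ps {}"
  shows "\<exists>q \<in> fold greedy_step ps {}. meets q p \<and> P q p"
  using assms
proof (induction ps rule: rev_induct)
  case (snoc x ps)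
  let ?W = "fold greedy_step ps {}"
  have sub: "?W \<subseteq> fold greedy_step (ps @ [x]) {}"
    by (auto simp: greedy_step_def[of _ "fold greedy_step ps {}"])
  show ?case
  proof (cases "p \<in> set ps")
    case True
    then show ?thesis using snoc sub by (auto simp: sorted_wrt_append)
  next
    case False
    then have [simp]: "p = x" using snoc.prems by auto
    have "{fst x, snd x} \<inter> covered ?W \<noteq> {}"
      using snoc.prems(3) by (auto simp: greedy_step_def[of _ "fold greedy_step ps {}"] split: if_splits)
    then obtain q where "q \<in> ?W" "meets q x" using meets_covered by metis
    moreover from this greedy_subset[of ps] snoc.prems(1) have "P q x"
      by (auto simp: sorted_wrt_append)
    ultimately show ?thesis using sub by auto
  qed
qed simp

section \<open>Ranks of vertices\<close>

text \<open>The rank of an element of \<open>S\<close> is its position in the increasing list of \<open>S\<close>. Ranks are also taken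
  of vertices outside \<open>S\<close>: by \<open>rank_insert\<close>, the rank of \<open>v\<close> in \<open>\<alpha>\<close> is then the position
  that \<open>v\<close> will have in \<open>\<alpha> \<union> {v}\<close>.\<close>

definition rank :: "'a::linorder set \<Rightarrow> 'a \<Rightarrow> nat" where
  "rank S x = card {y \<in> S. y < x}"

lemma rank_insert:
  "finite S \<Longrightarrow> w \<notin> S \<Longrightarrow> rank (insert w S) x = rank S x + (if w < x then 1 else 0)"
proof -
  assume a: "finite S" "w \<notin> S"
  have "{y \<in> insert w S. y < x} = (if w < x then insert w {y \<in> S. y < x} else {y \<in> S. y < x})"
    by auto
  with a show ?thesis by (simp add: rank_def)
qed

lemma rank_mono: "finite S \<Longrightarrow> x \<le> y \<Longrightarrow> rank S x \<le> rank S y"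
  unfolding rank_def by (intro card_mono) auto

lemma rank_strict_mono: "finite S \<Longrightarrow> x \<in> S \<Longrightarrow> x < y \<Longrightarrow> rank S x < rank S y"
  unfolding rank_def by (intro psubset_card_mono) auto

lemma rank_nth:
  assumes "finite S" "r < card S"
  shows "rank S (sorted_list_of_set S ! r) = r"
proof -
  let ?xs = "sorted_list_of_set S"
  have st: "sorted_wrt (<) ?xs" by simp
  have len: "length ?xs = card S" by simp
  have less: "?xs ! i < ?xs ! j \<longleftrightarrow> i < j" if "i < card S" "j < card S" for i j
    using that st len by (metis linorder_neqE_nat order.asym sorted_wrt_nth_less)
  have mem: "y \<in> S \<longleftrightarrow> (\<exists>i<card S. ?xs ! i = y)" for y
    using assms(1) len by (metis in_set_conv_nth set_sorted_list_of_set)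
  have "{y \<in> S. y < ?xs ! r} = (!) ?xs ` {..<r}"
    using less assms(2) by (auto simp: mem image_iff) (metis less_trans)+
  moreover have "inj_on ((!) ?xs) {..<r}"
    using assms(2) by (intro inj_on_nth) auto
  ultimately show ?thesis by (simp add: rank_def card_image)
qed

lemma appears_in_position_iff_rank:
  assumes "finite S"
  shows "appears_in_position v r S \<longleftrightarrow> v \<in> S \<and> rank S v = r"
proof
  assume "appears_in_position v r S"
  then show "v \<in> S \<and> rank S v = r"
    using rank_nth[OF assms, of r] nth_mem[of r "sorted_list_of_set S"] assms
    by (auto simp: appears_in_position_def)
next
  assume v: "v \<in> S \<and> rank S v = r"
  then obtain j where j: "j < card S" "sorted_list_of_set S ! j = v"
    using assms by (metis in_set_conv_nth length_sorted_list_of_set set_sorted_list_of_set)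
  with rank_nth[OF assms, of j] v show "appears_in_position v r S"
    by (auto simp: appears_in_position_def)
qed

section \<open>The key of a pair\<close>

text \<open>In a codimension-one pair the difference is a singleton, so the key depends only on the pair of
  faces, and it can be read off without knowing at which point of the loops the pair was tried.\<close>

fun key :: "'a::linorder set \<times> 'a set \<Rightarrow> nat \<times> nat \<times> 'a" where
  "key (\<alpha>, \<beta>) = (let v = the_elem (\<beta> - \<alpha>) in (face_dim \<alpha>, rank \<alpha> v, v))"

lemma key_insert: "v \<notin> \<alpha> \<Longrightarrow> key (\<alpha>, insert v \<alpha>) = (face_dim \<alpha>, rank \<alpha> v, v)"
  by (simp add: insert_Diff_if)

declare key.simps [simp del]

lemma codim_oneE:
  assumes "finite_simplicial_complex K" "codim_one K \<alpha> \<beta>"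
  obtains v where "v \<notin> \<alpha>" "\<beta> = insert v \<alpha>" "finite \<alpha>" "card \<alpha> > 0"
proof -
  from assms have f: "finite \<alpha>" "finite \<beta>" "\<alpha> \<noteq> {}" "\<beta> \<noteq> {}" "\<alpha> \<subset> \<beta>" "card \<beta> - 1 = card \<alpha> - 1 + 1"
    by (auto simp: codim_one_def finite_simplicial_complex_def face_dim_def)
  then have "card \<alpha> > 0" by (simp add: card_gt_0_iff)
  with f have "card (\<beta> - \<alpha>) = 1" by (subst card_Diff_subset) auto
  then obtain v where "\<beta> - \<alpha> = {v}" by (metis card_1_singletonE)
  with f have "v \<notin> \<alpha>" "\<beta> = insert v \<alpha>" by auto
  with f \<open>card \<alpha> > 0\<close> that show thesis by blast
qed

section \<open>The algorithm as a greedy matching\<close>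

definition candidate :: "'a::linorder set set \<Rightarrow> nat \<Rightarrow> nat \<Rightarrow> 'a \<Rightarrow> 'a set \<Rightarrow> bool" where
  "candidate K i r v \<alpha> \<longleftrightarrow> \<alpha> \<in> faces K i \<and> v \<notin> \<alpha> \<and> \<alpha> \<union> {v} \<in> faces K (i + 1) \<and>
     appears_in_position v r (\<alpha> \<union> {v})"

definition level_pairs :: "'a::linorder set set \<Rightarrow> nat \<Rightarrow> ('a set \<times> 'a set) list" where
  "level_pairs K i = [(\<alpha>, \<alpha> \<union> {v}). r \<leftarrow> rev [0..<i + 2],
     v \<leftarrow> rev (sorted_list_of_set (vertices K)), \<alpha> \<leftarrow> lex_faces K i, candidate K i r v \<alpha>]"

definition all_pairs :: "'a::linorder set set \<Rightarrow> ('a set \<times> 'a set) list" where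
  "all_pairs K = concat (map (level_pairs K) (rev [0..<complex_dim K]))"

text \<open>Throughout the run, the families \<open>F\<^sup>i\<close> consist of the faces that \<open>W\<close> leaves uncovered, so a state
  is determined by its matching alone.\<close>

definition state_of :: "'a set set \<Rightarrow> ('a set \<times> 'a set) set \<Rightarrow> 'a state" where
  "state_of K W = (W, \<lambda>j. faces K j - covered W)"

lemma match_step_state_of:
  "match_step K i (r, v, \<alpha>) (state_of K W) =
   state_of K (if candidate K i r v \<alpha> then greedy_step (\<alpha>, \<alpha> \<union> {v}) W else W)"
  by (auto simp: match_step_def state_of_def candidate_def greedy_step_def faces_def fun_eq_iff)

lemma fold_concat_map: "fold f (concat (map g xs)) = fold (\<lambda>x. fold f (g x)) xs"
  by (induction xs) auto

lemma fold_transfer: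
  "(\<And>x W. x \<in> set xs \<Longrightarrow> f x (h W) = h (g x W)) \<Longrightarrow> fold f xs (h W) = h (fold g xs W)"
  by (induction xs arbitrary: W) auto

lemma fold_fixed: "(\<And>x. x \<in> set xs \<Longrightarrow> f x s = s) \<Longrightarrow> fold f xs s = s"
  by (induction xs) auto

lemma process_state_of:
  "process K i (state_of K W) = state_of K (fold greedy_step (level_pairs K i) W)"
proof -
  note tr = fold_transfer[where h = "state_of K"]
  show ?thesis
    unfolding process_def level_pairs_def fold_concat_map fold_map
    apply (rule tr)
    apply (rule tr)
    apply (rule tr)
    apply (simp add: match_step_state_of)
    done
qed

text \<open>Skipping a process when one of the families is exhausted changes nothing, since every pair
  of that level then has a covered face.\<close>

lemma run_process_state_of:
  "run_process K i (state_of K W) = state_of K (fold greedy_step (level_pairs K i) W)"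
proof (cases "snd (state_of K W) i \<noteq> {} \<and> snd (state_of K W) (i + 1) \<noteq> {}")
  case True
  then show ?thesis by (simp add: run_process_def process_state_of)
next
  case False
  have "greedy_step p W = W" if "p \<in> set (level_pairs K i)" for p
    using that False
    by (auto simp: level_pairs_def candidate_def state_of_def greedy_step_def)
  then have "fold greedy_step (level_pairs K i) W = W"
    by (rule fold_fixed)
  with False show ?thesis by (auto simp: run_process_def)
qed

lemma algorithm_matching_greedy: "algorithm_matching K = fold greedy_step (all_pairs K) {}"
proof -
  have "({}, faces K) = state_of K {}" by (auto simp: state_of_def covered_def)
  then have "algorithm_matching K = fst (state_of K
      (fold (\<lambda>i. fold greedy_step (level_pairs K i)) (rev [0..<complex_dim K]) {}))"
    by (simp only: algorithm_matching_def
        fold_transfer[where f = "run_process K", OF run_process_state_of])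
  then show ?thesis by (simp add: all_pairs_def fold_concat_map state_of_def)
qed

lemma set_lex_faces:
  assumes "finite_simplicial_complex K"
  shows "set (lex_faces K i) = faces K i"
proof -
  have "finite (faces K i)" "\<And>\<alpha>. \<alpha> \<in> faces K i \<Longrightarrow> finite \<alpha>"
    using assms by (auto simp: finite_simplicial_complex_def faces_def)
  then show ?thesis by (auto simp: lex_faces_def image_image)
qed

lemma set_all_pairs:
  assumes K: "finite_simplicial_complex K"
  shows "set (all_pairs K) = {(\<alpha>, \<beta>). codim_one K \<alpha> \<beta>}"
proof (intro set_eqI iffI)
  fix p assume "p \<in> set (all_pairs K)"
  then show "p \<in> {(\<alpha>, \<beta>). codim_one K \<alpha> \<beta>}"
    by (auto simp: all_pairs_def level_pairs_def candidate_def codim_one_def faces_def)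
next
  fix p assume "p \<in> {(\<alpha>, \<beta>). codim_one K \<alpha> \<beta>}"
  then obtain \<alpha> \<beta> where p: "p = (\<alpha>, \<beta>)" "codim_one K \<alpha> \<beta>" by auto
  from codim_oneE[OF K p(2)] obtain v where v: "v \<notin> \<alpha>" "\<beta> = insert v \<alpha>" "finite \<alpha>" "card \<alpha> > 0" .
  have fin: "finite K" "finite (vertices K)"
    using K by (auto simp: finite_simplicial_complex_def vertices_def)
  have mem: "\<alpha> \<in> K" "\<beta> \<in> K" "face_dim \<beta> = face_dim \<alpha> + 1" using p by (auto simp: codim_one_def)
  have "face_dim \<beta> \<le> Max (face_dim ` K)" using fin mem(2) by (intro Max_ge imageI finite_imageI)
  then have "face_dim \<beta> \<le> complex_dim K" using mem by (auto simp: complex_dim_def)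
  then have dim: "face_dim \<alpha> < complex_dim K" using mem by simp
  have app: "appears_in_position v (rank \<beta> v) \<beta>"
    using v by (subst appears_in_position_iff_rank) auto
  then have cand: "candidate K (face_dim \<alpha>) (rank \<beta> v) v \<alpha>"
    using v mem by (simp add: candidate_def faces_def)
  have r: "rank \<beta> v < face_dim \<alpha> + 2"
    using app v by (auto simp: appears_in_position_def face_dim_def)
  have "v \<in> vertices K" using v mem by (auto simp: vertices_def)
  then have "p \<in> set (level_pairs K (face_dim \<alpha>))"
    unfolding level_pairs_def p(1) using cand r v(2) fin(2)
    by (auto simp: set_lex_faces[OF K] candidate_def less_Suc_eq
        intro!: bexI[of _ "rank \<beta> v"] bexI[of _ v] bexI[of _ \<alpha>])
  with dim show "p \<in> set (all_pairs K)" by (auto simp: all_pairs_def)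
qed

lemma sorted_wrt_concat_map:
  assumes "sorted_wrt Q xs" "\<And>x. x \<in> set xs \<Longrightarrow> sorted_wrt P (f x)"
    "\<And>x y a b. Q x y \<Longrightarrow> a \<in> set (f x) \<Longrightarrow> b \<in> set (f y) \<Longrightarrow> P a b"
  shows "sorted_wrt P (concat (map f xs))"
  using assms by (induction xs) (fastforce simp: sorted_wrt_append)+

lemma key_candidate:
  assumes "finite_simplicial_complex K" "candidate K i r v \<alpha>"
  shows "key (\<alpha>, insert v \<alpha>) = (i, r, v)"
proof -
  have "finite \<alpha>" "v \<notin> \<alpha>" "face_dim \<alpha> = i" "appears_in_position v r (insert v \<alpha>)"
    using assms by (auto simp: candidate_def faces_def finite_simplicial_complex_def)
  then show ?thesis by (simp add: key_insert appears_in_position_iff_rank rank_insert)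
qed

text \<open>The three outer loops descend in the three components of the key. All pairs
  visited for one choice of these components have equal keys, whence the weak inequality.\<close>

lemma sorted_all_pairs:
  assumes K: "finite_simplicial_complex K"
  shows "sorted_wrt (\<lambda>p q. key p \<ge> key q) (all_pairs K)"
proof -
  note kc = key_candidate[OF K]
  have rev_upt: "sorted_wrt (>) (rev [0..<n])" for n :: nat
    by (simp add: sorted_wrt_rev)
  have rev_vs: "sorted_wrt (>) (rev (sorted_list_of_set (vertices K)))"
    by (simp add: sorted_wrt_rev)
  show ?thesis
    unfolding all_pairs_def level_pairs_def
    apply (rule sorted_wrt_concat_map[OF rev_upt])
     apply (rule sorted_wrt_concat_map[OF rev_upt])
      apply (rule sorted_wrt_concat_map[OF rev_vs])
       apply (rule sorted_wrt_concat_map[where Q = "\<lambda>_ _. True"])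
    by (auto simp: kc)
qed

lemma algorithm_blocked:
  assumes K: "finite_simplicial_complex K"
    and "codim_one K \<gamma> \<beta>" "(\<gamma>, \<beta>) \<notin> algorithm_matching K"
  obtains q where "q \<in> algorithm_matching K" "meets q (\<gamma>, \<beta>)" "key (\<gamma>, \<beta>) \<le> key q"
  using greedy_blocked[OF sorted_all_pairs[OF K], of "(\<gamma>, \<beta>)"] assms set_all_pairs[OF K]
  by (auto simp: algorithm_matching_greedy)

lemma algorithm_codim_one:
  "finite_simplicial_complex K \<Longrightarrow> (\<alpha>, \<beta>) \<in> algorithm_matching K \<Longrightarrow> codim_one K \<alpha> \<beta>"
  using greedy_subset[of "all_pairs K"] set_all_pairs[of K] by (auto simp: algorithm_matching_greedy)

lemma algorithm_disjoint:
  "p \<in> algorithm_matching K \<Longrightarrow> q \<in> algorithm_matching K \<Longrightarrow> meets p q \<Longrightarrow> p = q"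
  unfolding algorithm_matching_greedy by (rule greedy_disjoint)

section \<open>Acyclicity\<close>

text \<open>One step of the path, with \<open>m\<close> in position \<open>c\<close> of \<open>\<beta>\<close>. The
  removed \<open>w\<close> is in a position \<open>\<le> c\<close>: for \<open>w < v\<close> because \<open>v\<close> is, and for \<open>v < w\<close> because the
  assumption on that case bounds its position by that of \<open>v'\<close>. If \<open>w = m\<close>, then \<open>v < w\<close>, and that assumption puts a vertex
  above \<open>m\<close> into position \<open>c\<close>. If \<open>w < m\<close>, then \<open>m\<close> drops to position \<open>c - 1\<close> in \<open>\<gamma>\<close>; adding
  \<open>v'\<close> below position \<open>c\<close> lifts it back to \<open>c\<close>, while adding \<open>v'\<close> in position \<open>c\<close> puts
  \<open>v'\<close> there instead, above \<open>m\<close>.\<close>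

lemma rank_climbs:
  assumes fin: "finite \<alpha>" "finite \<gamma>"
    and \<alpha>: "v \<notin> \<alpha>" "\<beta> = insert v \<alpha>" and \<gamma>: "w \<notin> \<gamma>" "\<beta> = insert w \<gamma>" "w \<noteq> v"
    and \<delta>: "v' \<notin> \<gamma>" "\<delta> = insert v' \<gamma>"
    and climb: "v < w \<Longrightarrow> (rank \<gamma> w, w) < (rank \<gamma> v', v')"
    and le: "rank \<alpha> v \<le> c" "rank \<gamma> v' \<le> c"
    and m: "m \<in> \<beta>" "rank \<beta> m = c"
  shows "\<exists>m'\<in>\<delta>. rank \<delta> m' = c \<and> m \<le> m' \<and> (rank \<gamma> v' = c \<longrightarrow> m < m')"
proof -
  have fb: "finite \<beta>" and w: "w \<in> \<beta>" using fin \<alpha> \<gamma> by auto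
  have rv: "rank \<beta> v = rank \<alpha> v" using \<alpha> fin rank_insert by fastforce
  have rw: "rank \<beta> w = rank \<gamma> w" using \<gamma> fin rank_insert by fastforce
  have rv': "rank \<delta> v' = rank \<gamma> v'" using \<delta> fin rank_insert by fastforce
  have "rank \<beta> w \<le> c"
  proof (cases "v < w")
    case True
    with climb le rw show ?thesis by auto
  next
    case False
    then have "rank \<beta> w \<le> rank \<beta> v" using fb by (intro rank_mono) auto
    with rv le show ?thesis by simp
  qed
  then have "w \<le> m" using rank_strict_mono[OF fb m(1), of w] m(2) by force
  show ?thesis
  proof (cases "w = m")
    case True
    have "v < w"
      using rank_strict_mono[OF fb w, of v] \<gamma>(3) rv le m(2) True by force
    from climb[OF this] have "rank \<gamma> v' = c" "w < v'" using rw m(2) True le by auto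
    with True rv' \<delta> show ?thesis by auto
  next
    case False
    with \<open>w \<le> m\<close> have "w < m" by simp
    then have mg: "m \<in> \<gamma>" "Suc (rank \<gamma> m) = c"
      using m \<gamma> fin(2) by (auto simp: rank_insert)
    show ?thesis
    proof (cases "rank \<gamma> v' = c")
      case True
      then have "m < v'" using rank_mono[OF fin(2), of v' m] mg by force
      with True rv' \<delta> show ?thesis by auto
    next
      case False
      then have "\<not> m < v'" using rank_strict_mono[OF fin(2) mg(1), of v'] mg le by force
      then have "v' < m" using mg \<delta> by (metis linorder_neqE)
      then have "rank \<delta> m = c" using \<delta> fin(2) mg by (simp add: rank_insert)
      with False mg \<delta> show ?thesis by auto
    qed
  qed
qed

text \<open>The rejected pair \<open>\<gamma> \<nearrow> \<beta>\<close> is blocked through \<open>\<gamma>\<close> or through \<open>\<beta>\<close>. The only accepted pair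
  through \<open>\<beta>\<close> is \<open>\<alpha> \<nearrow> \<beta>\<close>, whose key is too small to block, so it is blocked by \<open>\<gamma> \<nearrow> \<delta>\<close>.\<close>

lemma algorithm_key_increases:
  assumes K: "finite_simplicial_complex K"
    and \<alpha>: "(\<alpha>, \<beta>) \<in> algorithm_matching K"
    and \<gamma>: "codim_one K \<gamma> \<beta>" "(\<gamma>, \<beta>) \<notin> algorithm_matching K"
    and \<delta>: "(\<gamma>, \<delta>) \<in> algorithm_matching K"
    and less: "key (\<alpha>, \<beta>) < key (\<gamma>, \<beta>)"
  shows "key (\<gamma>, \<beta>) < key (\<gamma>, \<delta>)"
proof -
  obtain q where q: "q \<in> algorithm_matching K" "meets q (\<gamma>, \<beta>)" "key (\<gamma>, \<beta>) \<le> key q"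
    using algorithm_blocked[OF K \<gamma>] .
  from q(2) have "meets q (\<alpha>, \<beta>) \<or> meets q (\<gamma>, \<delta>)" by (auto simp: meets_def)
  then have "q = (\<alpha>, \<beta>) \<or> q = (\<gamma>, \<delta>)" using algorithm_disjoint q(1) \<alpha> \<delta> by blast
  with q(3) less have le: "key (\<gamma>, \<beta>) \<le> key (\<gamma>, \<delta>)" by auto
  obtain w where w: "w \<notin> \<gamma>" "\<beta> = insert w \<gamma>" using codim_oneE[OF K \<gamma>(1)] .
  obtain u where u: "u \<notin> \<gamma>" "\<delta> = insert u \<gamma>"
    using codim_oneE[OF K algorithm_codim_one[OF K \<delta>]] .
  have "u \<noteq> w" using w u \<gamma>(2) \<delta> by auto
  then have "key (\<gamma>, \<beta>) \<noteq> key (\<gamma>, \<delta>)" using w u by (simp add: key_insert)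
  with le show ?thesis by simp
qed

text \<open>A cycle is unrolled to a periodic infinite path, so that one can start at a step where the
  maximal position \<open>c\<close> is attained and come back to it after one period.\<close>

lemma no_periodic_path:
  assumes K: "finite_simplicial_complex K" and "k \<ge> 1"
    and up: "\<And>j. (\<alpha> j, \<beta> j) \<in> algorithm_matching K"
    and down: "\<And>j. down_edge K (algorithm_matching K) (\<beta> j) (\<alpha> (Suc j))"
    and per: "\<And>j. \<alpha> (j + k) = \<alpha> j" "\<And>j. \<beta> (j + k) = \<beta> j"
  shows False
proof -
  have "\<exists>v. v \<notin> \<alpha> j \<and> \<beta> j = insert v (\<alpha> j)" for j
    using codim_oneE[OF K algorithm_codim_one[OF K up]] by metis
  then obtain v where v: "v j \<notin> \<alpha> j" "\<beta> j = insert (v j) (\<alpha> j)" for j by metis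
  have fin: "finite (\<alpha> j)" for j
    using codim_oneE[OF K algorithm_codim_one[OF K up]] by metis
  have card: "face_dim (\<beta> j) = face_dim (\<alpha> j) + 1" "face_dim (\<beta> j) = face_dim (\<alpha> (Suc j)) + 1" for j
    using down[of j] algorithm_codim_one[OF K up[of j]] by (auto simp: down_edge_def codim_one_def)
  have perv: "v (j + k) = v j" for j using v[of j] v[of "j + k"] per by auto
  define r where "r j = rank (\<alpha> j) (v j)" for j
  have "r j = r (j mod k)" for j
  proof (induction j rule: less_induct)
    case (less j)
    show ?case
    proof (cases "j < k")
      case False
      with less[of "j - k"] \<open>k \<ge> 1\<close> have "r (j - k) = r (j mod k)" by (auto simp: mod_if[of j])
      moreover have "r j = r (j - k)"
        using False per[of "j - k"] perv[of "j - k"] by (simp add: r_def)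
      ultimately show ?thesis by simp
    qed simp
  qed
  then have "range r \<subseteq> r ` {..<k}" using \<open>k \<ge> 1\<close> by fastforce
  then have "finite (range r)" by (rule finite_subset) simp
  define c where "c = Max (range r)"
  have c: "r j \<le> c" for j using \<open>finite (range r)\<close> by (simp add: c_def)
  have "c \<in> range r" unfolding c_def using \<open>finite (range r)\<close> by (intro Max_in) auto
  then obtain s where s: "r s = c" by blast
  have step: "\<exists>m'\<in>\<beta> (Suc j). rank (\<beta> (Suc j)) m' = c \<and> m \<le> m' \<and> (r (Suc j) = c \<longrightarrow> m < m')"
    if m: "m \<in> \<beta> j" "rank (\<beta> j) m = c" for j m
  proof -
    obtain w where w: "w \<notin> \<alpha> (Suc j)" "\<beta> j = insert w (\<alpha> (Suc j))"
      using codim_oneE[OF K] down[of j] unfolding down_edge_def by metis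
    have "(\<alpha> (Suc j), \<beta> j) \<notin> algorithm_matching K" "codim_one K (\<alpha> (Suc j)) (\<beta> j)"
      using down[of j] by (auto simp: down_edge_def)
    note inc = algorithm_key_increases[OF K up[of j] this(2,1) up]
    have "\<alpha> (Suc j) \<noteq> \<alpha> j" using up[of j] down[of j] by (auto simp: down_edge_def)
    then have "w \<noteq> v j" using w v[of j] by (metis Diff_insert_absorb)
    moreover have "(rank (\<alpha> (Suc j)) w, w) < (rank (\<alpha> (Suc j)) (v (Suc j)), v (Suc j))" if "v j < w"
    proof -
      have "rank (\<beta> j) (v j) < rank (\<beta> j) w"
        using that v[of j] fin by (intro rank_strict_mono) auto
      moreover have "rank (\<beta> j) (v j) = rank (\<alpha> j) (v j)" "rank (\<beta> j) w = rank (\<alpha> (Suc j)) w"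
        using rank_insert[OF fin[of j] v(1)[of j]] rank_insert[OF fin[of "Suc j"] w(1)] v(2)[of j] w(2)
        by fastforce+
      ultimately have "key (\<alpha> j, \<beta> j) < key (\<alpha> (Suc j), \<beta> j)"
        using key_insert[OF v(1)[of j]] key_insert[OF w(1)] v(2)[of j] w(2) card[of j] by simp
      from inc[OF this] show ?thesis
        using key_insert[OF v(1)[of "Suc j"]] key_insert[OF w(1)] v(2)[of "Suc j"] w(2) by simp
    qed
    ultimately show ?thesis
      using rank_climbs[OF fin fin v[of j] w _ v[of "Suc j"] _ _ _ m] c[of j] c[of "Suc j"]
      by (simp add: r_def)
  qed
  \<comment> \<open>The vertex in position \<open>c\<close> at step \<open>s\<close> is the added vertex \<open>v s\<close> itself, where the climb starts.\<close>
  have reach: "\<exists>m\<in>\<beta> (s + n). rank (\<beta> (s + n)) m = c \<and> v s \<le> m \<and> (n > 0 \<and> r (s + n) = c \<longrightarrow> v s < m)" for n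
  proof (induction n)
    case 0
    then show ?case using s v[of s] fin[of s] by (auto simp: rank_insert r_def)
  next
    case (Suc n)
    then obtain m where "m \<in> \<beta> (s + n)" "rank (\<beta> (s + n)) m = c" "v s \<le> m" by blast
    with step[OF this(1,2)] show ?case by force
  qed
  have "r (s + k) = c" using per[of s] perv[of s] s by (simp add: r_def)
  then obtain m where m: "m \<in> \<beta> s" "rank (\<beta> s) m = c" "v s < m"
    using reach[of k] \<open>k \<ge> 1\<close> per by auto
  have "rank (\<beta> s) (v s) = c" using s v[of s] fin[of s] by (auto simp: rank_insert r_def)
  moreover have "rank (\<beta> s) (v s) < rank (\<beta> s) m"
    using m v[of s] fin[of s] by (intro rank_strict_mono) auto
  ultimately show False using m by simp
qed

lemma no_up_down_cycle:
  assumes K: "finite_simplicial_complex K"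
  shows "\<not> up_down_cycle K (algorithm_matching K) k \<alpha> \<beta>"
proof
  assume "up_down_cycle K (algorithm_matching K) k \<alpha> \<beta>"
  then have k: "k \<ge> 1" and clo: "\<alpha> k = \<alpha> 0"
    and up: "\<And>j. j < k \<Longrightarrow> (\<alpha> j, \<beta> (Suc j)) \<in> algorithm_matching K"
    and down: "\<And>j. j < k \<Longrightarrow> down_edge K (algorithm_matching K) (\<beta> (Suc j)) (\<alpha> (Suc j))"
    by (auto simp: up_down_cycle_def up_edge_def)
  have "\<alpha> (Suc j mod k) = \<alpha> (Suc (j mod k))" for j
    using clo by (simp add: mod_Suc)
  then show False
    using k up down
    by (intro no_periodic_path[OF K k, of "\<lambda>j. \<alpha> (j mod k)" "\<lambda>j. \<beta> (Suc (j mod k))"]) auto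
qed

text \<open>Dropping the first down-edge of the cycle and appending it at the end turns one kind of cycle
  into the other; the \<open>k\<close>-th lower face has to be set to the first one, because the given sequence
  need not be periodic beyond the indices of the cycle.\<close>

lemma down_up_cycle_shift:
  assumes "down_up_cycle K W k \<gamma> \<delta>"
  shows "up_down_cycle K W k (\<lambda>j. if j = k then \<delta> 1 else \<delta> (j + 1)) \<gamma>"
proof -
  from assms have k: "k \<ge> 1" and clo: "\<gamma> k = \<gamma> 0"
    and e: "\<And>j. j < k \<Longrightarrow> down_edge K W (\<gamma> j) (\<delta> (j + 1)) \<and> up_edge W (\<delta> (j + 1)) (\<gamma> (j + 1))"
    by (auto simp: down_up_cycle_def)
  have "down_edge K W (\<gamma> (j + 1)) (if j + 1 = k then \<delta> 1 else \<delta> (j + 1 + 1))" if "j < k" for j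
    using e[of "j + 1"] e[of 0] clo k that by (cases "j + 1 = k") auto
  with k e show ?thesis by (auto simp: up_down_cycle_def)
qed

theorem proposition3p1:
  fixes K :: "'a::linorder set set"
  assumes "finite_simplicial_complex K"
  shows "gradient_field K (algorithm_matching K)"
proof -
  have "partial_matching K (algorithm_matching K)"
    using algorithm_codim_one[OF assms] algorithm_disjoint
    unfolding partial_matching_def meets_def by blast
  then show ?thesis
    using no_up_down_cycle[OF assms] down_up_cycle_shift unfolding gradient_field_def by blast
qed

end
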